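(* For a classical self-crossing $c$ of a virtual link diagram $D$ and $\ast\in\{{\rm O},{\rm U}\}$, one has $\rho^{\ast}(c)={\rm ind}^{\ast}(c)$.
   Context: A virtual link diagram is a collection of immersed oriented loops in $\mathbb{R}^2$ whose multiple points are transverse double points, each of which is either a classical crossing (with over/under information, and with a sign ${\rm sgn}(c)\in\{+1,-1\}$ as usual) or a virtual crossing (without over/under information). A classical self-crossing is a classical crossing whose over and under paths lie on the same component of $D$. For a classical self-crossing $c$, smoothing $D$ at $c$ respecting the orientation splits the component through $c$ into two: the over counting component $D_c^{\rm O}$, which leaves $c$ along the outgoing over strand and returns to $c$ along the incoming under strand, and the under counting component $D_c^{\rm U}$, which leaves $c$ along the outgoing under strand and returns along the incoming over strand. For $\ast\in\{{\rm O},{\rm U}\}$ let $\gamma_1,\dots,\gamma_k$ be the sequence of classical crossings of $D$ met when travelling once along $D_c^\ast$ from a point near $c$ back to that point ($c$ itself is not included; crossings with other components are included; a self-crossing of $D_c^\ast$ appears twice). The flat sign $\iota(\gamma_i,D_c^\ast)$ is ${\rm sgn}(\gamma_i)$ if $\gamma_i$ is passed as an under crossing and $-{\rm sgn}(\gamma_i)$ if passed as an over crossing, and ${\rm ind}^\ast(c)=\sum_i\iota(\gamma_i,D_c^\ast)$. A semi-arc of $D$ is an immersed arc in a component of $D$ whose endpoints are classical crossings (with no classical crossing in its interior) or an immersed loop missing the classical crossings; it may pass through virtual crossings. An oriented cut point is a point on a semi-arc (away from crossings) together with a local orientation of the semi-arc there; it is coherent if this local orientation agrees with the orientation of $D$ and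 incoherent otherwise. A cut system of $D$ is a finite set of oriented cut points such that one can assign integers to the pieces into which the cut points divide the semi-arcs so that: at each classical crossing, viewed so that both strands run upward, for some $i\in\mathbb{Z}$ the incoming and outgoing pieces on the right-hand side are both numbered $i$ and the incoming and outgoing pieces on the left-hand side are both numbered $i+1$; numbers are unchanged along a strand through a virtual crossing; and at each oriented cut point the number increases by one in the direction of the cut point. Every virtual link diagram admits a cut system. For a cut system $C$ of $D$, $\rho^\ast(c,C)$ is the number of incoherent cut points of $C$ on $D_c^\ast$ minus the number of coherent ones. It does not depend on the choice of $C$, and $\rho^\ast(c)$ denotes $\rho^\ast(c,C)$ for any cut system $C$ of $D$. *)

theory Defs
  imports "HOL-Analysis.Analysis"
begin

text \<open>
  A parameter point \<^term>\<open>(j, z)\<close> is the point \<^term>\<open>z\<close> of the unit circle that parametrizes the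
  \<^term>\<open>j\<close>-th component. Components are oriented by the counterclockwise direction of the circle.
\<close>

type_synonym param = "nat \<times> complex"

text \<open>
  The double points of the plane image outside \<open>classical\<close> are the virtual crossings. At a
  classical crossing \<open>c\<close>, \<open>over_param D c\<close> is the parameter point at which \<open>c\<close> is passed
  as an over crossing.
\<close>

record vdiagram =
  num_comps :: nat
  loop :: "nat \<Rightarrow> complex \<Rightarrow> real^2"
  classical :: "(real^2) set"
  over_param :: "real^2 \<Rightarrow> param"

definition params :: "vdiagram \<Rightarrow> param set" where
  "params D = {..<num_comps D} \<times> sphere 0 1"

definition plane_point :: "vdiagram \<Rightarrow> param \<Rightarrow> real^2" where
  "plane_point D x = loop D (fst x) (snd x)"

definition move :: "param \<Rightarrow> real \<Rightarrow> param" where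
  "move x t = (fst x, snd x * cis t)"

definition velocity :: "vdiagram \<Rightarrow> param \<Rightarrow> real^2" where
  "velocity D x = vector_derivative (\<lambda>t. plane_point D (move x t)) (at 0)"

definition fibre :: "vdiagram \<Rightarrow> real^2 \<Rightarrow> param set" where
  "fibre D p = {x \<in> params D. plane_point D x = p}"

definition multiple_points :: "vdiagram \<Rightarrow> (real^2) set" where
  "multiple_points D = {p. \<exists>x\<in>fibre D p. \<exists>y\<in>fibre D p. x \<noteq> y}"

definition det2 :: "real^2 \<Rightarrow> real^2 \<Rightarrow> real" where
  "det2 v w = det (vector [v, w] :: real^2^2)"

definition virtual_link_diagram :: "vdiagram \<Rightarrow> bool" where
  "virtual_link_diagram D \<longleftrightarrow>
     (\<forall>j<num_comps D. (\<lambda>t. loop D j (cis t)) C1_differentiable_on UNIV) \<and>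
     (\<forall>x\<in>params D. velocity D x \<noteq> 0) \<and>
     (\<forall>p\<in>multiple_points D. card (fibre D p) = 2 \<and>
        (\<forall>x\<in>fibre D p. \<forall>y\<in>fibre D p. x \<noteq> y \<longrightarrow> det2 (velocity D x) (velocity D y) \<noteq> 0)) \<and>
     classical D \<subseteq> multiple_points D \<and>
     (\<forall>c\<in>classical D. over_param D c \<in> fibre D c)"

definition under_param :: "vdiagram \<Rightarrow> real^2 \<Rightarrow> param" where
  "under_param D c = (THE x. x \<in> fibre D c \<and> x \<noteq> over_param D c)"

text \<open>
  A crossing is positive iff the over strand has to be turned counterclockwise (by less than a
  half turn) to point along the under strand.
\<close>

definition crossing_sign :: "vdiagram \<Rightarrow> real^2 \<Rightarrow> int" where
  "crossing_sign D c =
     (if det2 (velocity D (over_param D c)) (velocity D (under_param D c)) > 0 then 1 else - 1)"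

definition classical_self_crossing :: "vdiagram \<Rightarrow> real^2 \<Rightarrow> bool" where
  "classical_self_crossing D c \<longleftrightarrow>
     c \<in> classical D \<and> fst (over_param D c) = fst (under_param D c)"

datatype strand = OverStrand | UnderStrand

text \<open>
  For distinct parameter points \<^term>\<open>x\<close> and \<^term>\<open>y\<close> on the same component, \<open>open_path x y\<close> is the
  open arc traversed from \<^term>\<open>x\<close>, in the direction of the component, up to the first arrival
  at \<^term>\<open>y\<close>.
\<close>

definition open_path :: "param \<Rightarrow> param \<Rightarrow> param set" where
  "open_path x y = {move x t | t. 0 < t \<and> (\<forall>s\<in>{0<..t}. move x s \<noteq> y)}"

text \<open>The counting components, with the point at the crossing itself removed.\<close>

fun counting_component :: "vdiagram \<Rightarrow> strand \<Rightarrow> real^2 \<Rightarrow> param set" where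
  "counting_component D OverStrand c = open_path (over_param D c) (under_param D c)"
| "counting_component D UnderStrand c = open_path (under_param D c) (over_param D c)"

definition classical_params :: "vdiagram \<Rightarrow> param set" where
  "classical_params D = {x \<in> params D. plane_point D x \<in> classical D}"

definition flat_sign :: "vdiagram \<Rightarrow> param \<Rightarrow> int" where
  "flat_sign D x =
     (let c = plane_point D x
      in if x = under_param D c then crossing_sign D c else - crossing_sign D c)"

text \<open>
  The sum is over passages, i.e. parameter points, so that a self-crossing of the counting
  component contributes two terms.
\<close>

definition ind :: "vdiagram \<Rightarrow> strand \<Rightarrow> real^2 \<Rightarrow> int" where
  "ind D s c = (\<Sum>x\<in>counting_component D s c \<inter> classical_params D. flat_sign D x)"

text \<open>
  Semi-arcs (without their endpoints) are represented by sets of parameter points. The factor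
  \<^typ>\<open>nat\<close> of \<^typ>\<open>param\<close> is discrete, so that topological components stay within a single
  component of the diagram. A virtual crossing does not interrupt a semi-arc.
\<close>

definition semi_arcs :: "vdiagram \<Rightarrow> param set set" where
  "semi_arcs D = components (params D - classical_params D)"

datatype direction = Coherent | Incoherent

type_synonym cut_point = "param \<times> direction"

definition cut_points :: "vdiagram \<Rightarrow> cut_point set" where
  "cut_points D = {(x, d). \<exists>A\<in>semi_arcs D. x \<in> A \<and> plane_point D x \<notin> multiple_points D}"

definition pieces :: "vdiagram \<Rightarrow> cut_point set \<Rightarrow> param set set" where
  "pieces D C = (\<Union>A\<in>semi_arcs D. components (A - fst ` C))"

definition incoming :: "vdiagram \<Rightarrow> cut_point set \<Rightarrow> param \<Rightarrow> param set" where
  "incoming D C x = (THE P. P \<in> pieces D C \<and> (\<forall>\<^sub>F t in at_left 0. move x t \<in> P))"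

definition outgoing :: "vdiagram \<Rightarrow> cut_point set \<Rightarrow> param \<Rightarrow> param set" where
  "outgoing D C x = (THE P. P \<in> pieces D C \<and> (\<forall>\<^sub>F t in at_right 0. move x t \<in> P))"

text \<open>
  In the crossing condition, \<^term>\<open>det2 (velocity D x) (velocity D y) > 0\<close> means that, with both
  strands running upward, the strand of \<^term>\<open>x\<close> goes from the lower left to the upper right and the
  strand of \<^term>\<open>y\<close> from the lower right to the upper left. So the pieces on the right-hand side are
  the incoming piece of \<^term>\<open>y\<close> and the outgoing piece of \<^term>\<open>x\<close>.
\<close>

definition cut_numbering :: "vdiagram \<Rightarrow> cut_point set \<Rightarrow> (param set \<Rightarrow> int) \<Rightarrow> bool" where
  "cut_numbering D C \<nu> \<longleftrightarrow>
     (\<forall>c\<in>classical D. \<forall>x\<in>fibre D c. \<forall>y\<in>fibre D c. det2 (velocity D x) (velocity D y) > 0 \<longrightarrow>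
        (\<exists>i. \<nu> (incoming D C y) = i \<and> \<nu> (outgoing D C x) = i \<and>
             \<nu> (incoming D C x) = i + 1 \<and> \<nu> (outgoing D C y) = i + 1)) \<and>
     (\<forall>x. (x, Coherent) \<in> C \<longrightarrow> \<nu> (outgoing D C x) = \<nu> (incoming D C x) + 1) \<and>
     (\<forall>x. (x, Incoherent) \<in> C \<longrightarrow> \<nu> (incoming D C x) = \<nu> (outgoing D C x) + 1)"

definition cut_system :: "vdiagram \<Rightarrow> cut_point set \<Rightarrow> bool" where
  "cut_system D C \<longleftrightarrow> finite C \<and> C \<subseteq> cut_points D \<and> (\<exists>\<nu>. cut_numbering D C \<nu>)"

definition rho_wrt :: "vdiagram \<Rightarrow> cut_point set \<Rightarrow> strand \<Rightarrow> real^2 \<Rightarrow> int" where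
  "rho_wrt D C s c =
     int (card {x \<in> counting_component D s c. (x, Incoherent) \<in> C}) -
     int (card {x \<in> counting_component D s c. (x, Coherent) \<in> C})"

text \<open>The common value of \<^const>\<open>rho_wrt\<close> over all cut systems of the diagram.\<close>

definition rho :: "vdiagram \<Rightarrow> strand \<Rightarrow> real^2 \<Rightarrow> int" where
  "rho D s c = (THE r. \<forall>C. cut_system D C \<longrightarrow> rho_wrt D C s c = r)"

end

theory Submission
  imports Defs
begin

text \<open>
  Fix a cut system \<open>C\<close> with a numbering \<open>\<nu>\<close> and travel along the counting component, from the
  crossing \<open>c\<close> back to \<open>c\<close>. The number of the current piece jumps by 1 at a coherent cut point and
  by -1 at an incoherent one. At a passage through a classical crossing it jumps by the flat sign
  of the passage: both the jump and the flat sign are 1 if the other strand crosses from left to right and -1 if it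
  crosses from right to left, regardless of which strand is on top (\<open>flat_sign_of_det2\<close>,
  \<open>numbering_jump\<close>). At \<open>c\<close> itself, the outgoing piece of each strand carries the number of the
  incoming piece of the other strand, so the number comes back to its initial value
  (\<open>numbering_closes_up\<close>) and the jumps add up to zero. This is the identity
  \<open>rho_wrt D C s c = ind D s c\<close> (\<open>rho_wrt_eq_ind\<close>).

  The value \<open>rho D s c\<close> is the common value for all cut systems, and is pinned down only if there is a
  cut system. One is built locally: number everything 0, except for a short piece
  at each passage through a classical crossing, which carries the number 1 forced by the
  crossing condition and is separated from the rest by one cut point (\<open>cut_system_exists\<close>).

  Both parts need that there are only finitely many crossings. This follows by compactness from
  the fact that the components are immersed and meet transversely (\<open>finite_multiple_params\<close>).
\<close>

section \<open>Travelling along a component\<close>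

lemma move_0 [simp]: "move x 0 = x"
  by (simp add: move_def)

lemma move_move [simp]: "move (move x s) t = move x (s + t)"
  by (simp add: move_def cis_mult mult.assoc)

lemma fst_move [simp]: "fst (move x t) = fst x"
  by (simp add: move_def)

lemma move_in_params [simp]: "move x t \<in> params D \<longleftrightarrow> x \<in> params D"
  by (cases x) (auto simp: move_def params_def norm_mult)

lemma continuous_on_move [continuous_intros]: "continuous_on S (move x)"
  unfolding move_def by (intro continuous_intros)

lemma move_eq_move_iff:
  assumes "x \<in> params D"
  shows "move x s = move x t \<longleftrightarrow> (\<exists>n. s = t + of_int (2 * n) * pi)"
proof -
  have "snd x \<noteq> 0"
    using assms by (auto simp: params_def)
  then have "move x s = move x t \<longleftrightarrow> exp (\<i> * of_real s) = exp (\<i> * of_real t)"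
    by (simp add: move_def cis_conv_exp)
  also have "\<dots> \<longleftrightarrow> (\<exists>n. \<i> * of_real s = \<i> * of_real t + of_int (2 * n) * of_real pi * \<i>)"
    by (simp add: exp_eq)
  also have "\<dots> \<longleftrightarrow> (\<exists>n. s = t + of_int (2 * n) * pi)"
    by (auto simp: complex_eq_iff)
  finally show ?thesis .
qed

lemma move_eq_imp_eq:
  assumes "x \<in> params D" "move x s = move x t" "\<bar>s - t\<bar> < 2 * pi"
  shows "s = t"
proof -
  obtain n where n: "s = t + of_int (2 * n) * pi"
    using assms move_eq_move_iff by blast
  then have "\<bar>of_int n\<bar> * (2 * pi) < 1 * (2 * pi)"
    using assms(3) by (simp add: abs_mult)
  then have "\<bar>real_of_int n\<bar> < 1"
    by (simp only: mult_less_cancel_right) auto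
  then show ?thesis
    using n by simp
qed

lemma move_reaches:
  assumes "x \<in> params D" "y \<in> params D" "fst x = fst y"
  obtains t where "a \<le> t" "t < a + 2 * pi" "move x t = y"
proof -
  define w where "w = snd y / (snd x * cis a)"
  have w: "norm w = 1" and nz: "snd x \<noteq> 0"
    using assms by (auto simp: w_def params_def norm_divide norm_mult)
  have "w = cis (Arg2pi w)"
    using Arg2pi_eq[of w] w by (simp add: cis_conv_exp mult.commute)
  then have "move x (a + Arg2pi w) = y"
    using assms(3) nz by (simp add: move_def prod_eq_iff flip: cis_mult)
      (simp add: w_def)
  then show ?thesis
    using that[of "a + Arg2pi w"] Arg2pi_ge_0[of w] Arg2pi_lt_2pi[of w] by auto
qed

text \<open>
  The first return to the crossing happens before a full turn, so the counting components are
  embedded open intervals of travel times.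
\<close>

lemma open_path_eq_image:
  assumes "x \<in> params D" "y \<in> params D" "fst x = fst y" "x \<noteq> y"
  obtains T where "0 < T" "T < 2 * pi" "move x T = y" "open_path x y = move x ` {0<..<T}"
proof -
  obtain T where T: "0 \<le> T" "T < 0 + 2 * pi" "move x T = y"
    using move_reaches[OF assms(1-3)] by blast
  then have T0: "0 < T"
    using assms(4) by (cases "T = 0") auto
  have "(\<forall>s\<in>{0<..t}. move x s \<noteq> y) \<longleftrightarrow> t < T" if "0 < t" for t
  proof
    show "t < T" if "\<forall>s\<in>{0<..t}. move x s \<noteq> y"
      using bspec[OF that, of T] T0 T(3) by fastforce
    show "\<forall>s\<in>{0<..t}. move x s \<noteq> y" if "t < T"
    proof safe
      fix s assume s: "s \<in> {0<..t}" "y = move x s"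
      then have "s = T"
        using T that by (intro move_eq_imp_eq[OF assms(1)]) auto
      then show False using s that by auto
    qed
  qed
  then have "0 < t \<and> (\<forall>s\<in>{0<..t}. move x s \<noteq> y) \<longleftrightarrow> t \<in> {0<..<T}" for t
    by auto
  then have "open_path x y = move x ` {0<..<T}"
    unfolding open_path_def image_def by auto
  then show ?thesis using that T0 T by auto
qed

lemma inj_on_move:
  assumes "x \<in> params D" "T \<le> 2 * pi"
  shows "inj_on (move x) {0<..<T}"
  using assms by (intro inj_onI move_eq_imp_eq[OF assms(1)]) auto

lemma eventually_move_notin_finite:
  assumes "x \<in> params D" "finite F"
  shows "\<forall>\<^sub>F t in at 0. move x t \<notin> F"
proof -
  have "\<forall>\<^sub>F t in at 0. move x t \<noteq> w" for w
  proof (cases "w = x")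
    case True
    have "\<forall>\<^sub>F t::real in at 0. t \<in> {-pi<..<pi} - {0}"
      using eventually_at_in_open[of "{-pi<..<pi}" "0::real"] by simp
    then show ?thesis
    proof eventually_elim
      case (elim t)
      have "move x t = move x 0 \<Longrightarrow> t = 0"
        using elim by (intro move_eq_imp_eq[OF assms(1)]) auto
      then show ?case using True elim by auto
    qed
  next
    case False
    have "isCont (move x) 0"
      using continuous_on_move[of UNIV x] by (simp add: continuous_on_eq_continuous_at)
    then have "(move x \<longlongrightarrow> x) (at 0)"
      by (simp add: isCont_def)
    then show ?thesis using False by (intro tendsto_imp_eventually_ne) auto
  qed
  then have "\<forall>\<^sub>F t in at 0. \<forall>w\<in>F. move x t \<noteq> w"
    using assms(2) by (simp add: eventually_ball_finite)
  then show ?thesis by (rule eventually_mono) blast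
qed

section \<open>Finiteness of the set of crossings\<close>

definition multiple_params :: "vdiagram \<Rightarrow> param set" where
  "multiple_params D = {x \<in> params D. plane_point D x \<in> multiple_points D}"

lemma multiple_paramsE:
  assumes "x \<in> multiple_params D"
  obtains y where "y \<in> params D" "y \<noteq> x" "plane_point D y = plane_point D x"
proof -
  obtain u v where "u \<in> fibre D (plane_point D x)" "v \<in> fibre D (plane_point D x)" "u \<noteq> v"
    using assms by (auto simp: multiple_params_def multiple_points_def)
  then show ?thesis using that[of u] that[of v] by (auto simp: fibre_def)
qed

lemma compact_params: "compact (params D)"
  unfolding params_def by (intro compact_Times compact_sphere finite_imp_compact finite_lessThan)

lemma param_curve_C1:
  assumes D: "virtual_link_diagram D" and x: "x \<in> params D"
  obtains f' where "\<And>t. ((\<lambda>t. plane_point D (move x t)) has_vector_derivative f' t) (at t)"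
    "continuous_on UNIV f'" "f' 0 = velocity D x"
proof -
  have j: "fst x < num_comps D" and n: "norm (snd x) = 1"
    using x by (auto simp: params_def)
  define \<theta> where "\<theta> = Arg2pi (snd x)"
  have \<theta>: "snd x = cis \<theta>"
    using Arg2pi_eq[of "snd x"] n by (simp add: cis_conv_exp \<theta>_def mult.commute)
  have "(\<lambda>t. loop D (fst x) (cis t)) C1_differentiable_on UNIV"
    using D j by (simp add: virtual_link_diagram_def)
  then obtain g where g: "\<And>t. ((\<lambda>t. loop D (fst x) (cis t)) has_vector_derivative g t) (at t)"
    and gc: "continuous_on UNIV g"
    unfolding C1_differentiable_on_def by auto
  have eq: "(\<lambda>t. plane_point D (move x t)) = (\<lambda>t. loop D (fst x) (cis t)) \<circ> (\<lambda>t. \<theta> + t)"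
    by (auto simp: plane_point_def move_def \<theta> cis_mult)
  have d: "((\<lambda>t. plane_point D (move x t)) has_vector_derivative g (\<theta> + t)) (at t)" for t
  proof -
    have "((\<lambda>t. \<theta> + t) has_vector_derivative 1) (at t)"
      by (auto intro!: derivative_eq_intros)
    from vector_diff_chain_at[OF this g] show ?thesis unfolding eq by simp
  qed
  show ?thesis
  proof (rule that)
    show "continuous_on UNIV (\<lambda>t. g (\<theta> + t))"
      by (intro continuous_on_compose2[OF gc] continuous_intros) auto
    show "g (\<theta> + 0) = velocity D x"
      unfolding velocity_def using vector_derivative_at[OF d[of 0]] by simp
  qed (use d in auto)
qed

text \<open>
  Projecting to the direction of the initial velocity gives a real function whose derivative is
  positive near the parameter.
\<close>

lemma C1_curve_locally_injective:
  fixes f :: "real \<Rightarrow> 'a::real_inner"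
  assumes d: "\<And>t. (f has_vector_derivative f' t) (at t)"
    and c: "continuous_on UNIV f'" and nz: "f' 0 \<noteq> 0"
  obtains r where "r > 0" "inj_on f {-r<..<r}"
proof -
  define u where "u = f' 0"
  have "isCont (\<lambda>t. f' t \<bullet> u) 0"
    using c by (auto intro!: continuous_intros simp: continuous_on_eq_continuous_at)
  then have "((\<lambda>t. f' t \<bullet> u) \<longlongrightarrow> u \<bullet> u) (at 0)"
    by (simp add: isCont_def u_def)
  moreover have "u \<bullet> u > 0" using nz by (simp add: u_def)
  ultimately have "\<forall>\<^sub>F t in at 0. f' t \<bullet> u > 0"
    by (rule order_tendstoD)
  then obtain r where r: "r > 0" "\<And>t. t \<noteq> 0 \<Longrightarrow> \<bar>t\<bar> < r \<Longrightarrow> f' t \<bullet> u > 0"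
    by (auto simp: eventually_at dist_real_def)
  have pos: "f' t \<bullet> u > 0" if "\<bar>t\<bar> < r" for t
    using r(2)[of t] that \<open>u \<bullet> u > 0\<close> by (cases "t = 0") (auto simp: u_def)
  have dh: "((\<lambda>t. f t \<bullet> u) has_real_derivative f' t \<bullet> u) (at t)" for t
    using has_derivative_inner_left[OF d[of t, unfolded has_vector_derivative_def], of u]
    by (rule has_derivative_imp_has_field_derivative) simp
  have less: "f a \<bullet> u < f b \<bullet> u" if "-r < a" "a < b" "b < r" for a b
  proof (rule DERIV_pos_imp_increasing[OF that(2)])
    fix t assume "a \<le> t" "t \<le> b"
    then show "\<exists>y. ((\<lambda>t. f t \<bullet> u) has_real_derivative y) (at t) \<and> y > 0"
      using dh[of t] pos[of t] that by (intro exI[of _ "f' t \<bullet> u"]) auto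
  qed
  have "inj_on f {-r<..<r}"
  proof (rule linorder_inj_onI')
    fix a b assume "a \<in> {-r<..<r}" "b \<in> {-r<..<r}" "a < b"
    then show "f a \<noteq> f b" using less[of a b] by fastforce
  qed
  then show ?thesis using that r(1) by blast
qed

lemma det2_eq: "det2 v w = v $ 1 * w $ 2 - v $ 2 * w $ 1"
  by (simp add: det2_def det_2)

text \<open>
  At a common point of the curves \<open>a v - b w = o(a) + o(b)\<close>. Taking the determinant with \<open>w\<close>
  bounds \<open>a\<close>, and with \<open>v\<close> it bounds \<open>b\<close>, by the same small quantity.
\<close>

lemma transverse_curves_locally_meet_once:
  fixes f g :: "real \<Rightarrow> real^2"
  assumes f: "(f has_vector_derivative v) (at 0)" and g: "(g has_vector_derivative w) (at 0)"
    and fg: "f 0 = g 0" and det: "det2 v w \<noteq> 0"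
  obtains r where "r > 0" "\<And>a b. \<bar>a\<bar> < r \<Longrightarrow> \<bar>b\<bar> < r \<Longrightarrow> f a = g b \<Longrightarrow> a = 0 \<and> b = 0"
proof -
  define m where "m = norm v + norm w"
  \<comment> \<open>chosen so that the determinant bounds yield \<open>\<bar>a\<bar> + \<bar>b\<bar> \<le> (\<bar>a\<bar> + \<bar>b\<bar>) / 2\<close>\<close>
  define e where "e = \<bar>det2 v w\<bar> / (4 * m)"
  have det2_le: "\<bar>det2 p q\<bar> \<le> 2 * norm p * norm q" for p q
  proof -
    have "\<bar>det2 p q\<bar> \<le> \<bar>p $ 1\<bar> * \<bar>q $ 2\<bar> + \<bar>p $ 2\<bar> * \<bar>q $ 1\<bar>"
      unfolding det2_eq by (simp flip: abs_mult)
    also have "\<dots> \<le> norm p * norm q + norm p * norm q"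
      by (intro add_mono mult_mono component_le_norm_cart) auto
    finally show ?thesis by simp
  qed
  have "v \<noteq> 0" using det by (auto simp: det2_eq)
  then have m: "m > 0" by (simp add: m_def add_pos_nonneg)
  then have e: "e > 0" using det by (simp add: e_def)
  have "\<exists>r>0. \<forall>t. \<bar>t\<bar> < r \<longrightarrow> norm (h t - h 0 - t *\<^sub>R u) \<le> e * \<bar>t\<bar>"
    if "(h has_vector_derivative u) (at 0)" for h :: "real \<Rightarrow> real^2" and u
    using that e unfolding has_vector_derivative_def has_derivative_at_alt by auto
  then obtain r1 r2 where r: "r1 > 0" "r2 > 0"
    and r1: "\<And>t. \<bar>t\<bar> < r1 \<Longrightarrow> norm (f t - f 0 - t *\<^sub>R v) \<le> e * \<bar>t\<bar>"
    and r2: "\<And>t. \<bar>t\<bar> < r2 \<Longrightarrow> norm (g t - g 0 - t *\<^sub>R w) \<le> e * \<bar>t\<bar>"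
    using f g by metis
  have "a = 0 \<and> b = 0" if ab: "\<bar>a\<bar> < min r1 r2" "\<bar>b\<bar> < min r1 r2" and eq: "f a = g b" for a b
  proof -
    define d where "d = a *\<^sub>R v - b *\<^sub>R w"
    have "d = (g b - g 0 - b *\<^sub>R w) - (f a - f 0 - a *\<^sub>R v)"
      using eq fg by (simp add: d_def)
    then have "norm d \<le> norm (g b - g 0 - b *\<^sub>R w) + norm (f a - f 0 - a *\<^sub>R v)"
      by (simp only: norm_triangle_ineq4)
    also have "\<dots> \<le> e * (\<bar>a\<bar> + \<bar>b\<bar>)"
      using r1[of a] r2[of b] ab by (simp add: algebra_simps)
    finally have d: "norm d \<le> e * (\<bar>a\<bar> + \<bar>b\<bar>)" .
    have "det2 d w = a * det2 v w" "det2 d v = b * det2 v w"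
      by (simp_all add: d_def det2_eq algebra_simps)
    then have "\<bar>a\<bar> * \<bar>det2 v w\<bar> \<le> 2 * norm d * norm w" "\<bar>b\<bar> * \<bar>det2 v w\<bar> \<le> 2 * norm d * norm v"
      using det2_le[of d w] det2_le[of d v] by (simp_all add: abs_mult)
    then have "(\<bar>a\<bar> + \<bar>b\<bar>) * \<bar>det2 v w\<bar> \<le> 2 * norm d * m"
      by (simp add: m_def algebra_simps)
    also have "\<dots> \<le> 2 * (e * (\<bar>a\<bar> + \<bar>b\<bar>)) * m"
      using d m by (intro mult_right_mono mult_left_mono) auto
    also have "\<dots> = (\<bar>a\<bar> + \<bar>b\<bar>) * \<bar>det2 v w\<bar> / 2"
      using m by (simp add: e_def field_simps)
    finally have "(\<bar>a\<bar> + \<bar>b\<bar>) * \<bar>det2 v w\<bar> \<le> 0" by linarith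
    then have "\<bar>a\<bar> + \<bar>b\<bar> \<le> 0"
      using det by (simp add: mult_le_0_iff)
    then show ?thesis by auto
  qed
  then show ?thesis using that[of "min r1 r2"] r by auto
qed

lemma convergent_params_lift:
  assumes "\<And>n. X n \<in> params D" "x \<in> params D" "X \<longlonglongrightarrow> x"
  obtains a where "a \<longlonglongrightarrow> 0" "\<forall>\<^sub>F n in sequentially. X n = move x (a n)"
proof -
  define a where "a n = Arg (snd (X n) / snd x)" for n
  have nx: "norm (snd x) = 1" and nX: "norm (snd (X n)) = 1" for n
    using assms(1)[of n] assms(2) by (auto simp: params_def)
  then have nz: "snd x \<noteq> 0" by auto
  have "(\<lambda>n. snd (X n) / snd x) \<longlonglongrightarrow> snd x / snd x"
    using nz by (intro tendsto_intros assms(3)) auto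
  then have "(\<lambda>n. snd (X n) / snd x) \<longlonglongrightarrow> 1" using nz by simp
  moreover have "isCont Arg 1"
    by (rule continuous_at_Arg) simp
  ultimately have "a \<longlonglongrightarrow> Arg 1"
    unfolding a_def using isCont_tendsto_compose by blast
  then have a: "a \<longlonglongrightarrow> 0" by simp
  have "(\<lambda>n. fst (X n)) \<longlonglongrightarrow> fst x"
    using assms(3) by (rule tendsto_fst)
  then have "\<forall>\<^sub>F n in sequentially. fst (X n) = fst x"
    by (simp add: tendsto_discrete)
  then have "\<forall>\<^sub>F n in sequentially. X n = move x (a n)"
  proof eventually_elim
    case (elim n)
    have "snd (X n) / snd x = cis (a n)"
      unfolding a_def using nx nX[of n] nz
      by (subst cis_Arg) (auto simp: norm_divide sgn_div_norm)
    then show ?case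
      using elim nz by (simp add: move_def prod_eq_iff field_simps)
  qed
  then show ?thesis using that a by blast
qed

text \<open>
  Infinitely many double points would accumulate. In the limit the two branches either merge,
  against local injectivity of an immersion, or meet in a double point that is not isolated,
  against transversality.
\<close>

lemma finite_multiple_params:
  assumes D: "virtual_link_diagram D"
  shows "finite (multiple_params D)"
proof (rule ccontr)
  assume inf: "infinite (multiple_params D)"
  obtain x where x: "x \<in> params D" "x islimpt multiple_params D"
    using Heine_Borel_imp_Bolzano_Weierstrass[OF compact_params[of D] inf]
    by (auto simp: multiple_params_def)
  then obtain X where X: "\<And>n. X n \<in> multiple_params D - {x}" "X \<longlonglongrightarrow> x"
    unfolding islimpt_sequential by auto
  have "\<forall>n. \<exists>y. y \<in> params D \<and> y \<noteq> X n \<and> plane_point D y = plane_point D (X n)"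
    using X(1) multiple_paramsE by (metis DiffD1)
  then obtain Y where Y: "\<And>n. Y n \<in> params D" "\<And>n. Y n \<noteq> X n"
    "\<And>n. plane_point D (Y n) = plane_point D (X n)"
    by metis
  have "seq_compact (params D)"
    using compact_params by (rule compact_imp_seq_compact)
  then obtain y k where y: "y \<in> params D" "strict_mono k" "(Y \<circ> k) \<longlonglongrightarrow> y"
    using Y(1) unfolding seq_compact_def by metis
  have Xk: "(X \<circ> k) \<longlonglongrightarrow> x"
    using X(2) y(2) by (rule LIMSEQ_subseq_LIMSEQ)
  have Xp: "(X \<circ> k) n \<in> params D" "(Y \<circ> k) n \<in> params D" for n
    using X(1)[of "k n"] Y(1) by (auto simp: multiple_params_def)
  obtain a where a: "a \<longlonglongrightarrow> 0" "\<forall>\<^sub>F n in sequentially. (X \<circ> k) n = move x (a n)"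
    using convergent_params_lift[OF Xp(1) x(1) Xk] .
  obtain b where b: "b \<longlonglongrightarrow> 0" "\<forall>\<^sub>F n in sequentially. (Y \<circ> k) n = move y (b n)"
    using convergent_params_lift[OF Xp(2) y(1) y(3)] .
  define f where "f t = plane_point D (move x t)" for t
  define g where "g t = plane_point D (move y t)" for t
  obtain f' where f': "\<And>t. (f has_vector_derivative f' t) (at t)" "continuous_on UNIV f'"
    "f' 0 = velocity D x"
    using param_curve_C1[OF D x(1)] unfolding f_def by metis
  obtain g' where g': "\<And>t. (g has_vector_derivative g' t) (at t)" "g' 0 = velocity D y"
    using param_curve_C1[OF D y(1)] unfolding g_def by metis
  have eq: "\<forall>\<^sub>F n in sequentially. f (a n) = g (b n)"
    using a(2) b(2) by eventually_elim (metis Y(3) f_def g_def comp_apply)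
  have small: "\<forall>\<^sub>F n in sequentially. \<bar>a n\<bar> < r \<and> \<bar>b n\<bar> < r" if "r > 0" for r
    using order_tendstoD(2)[OF tendsto_rabs_zero[OF a(1)] that]
      order_tendstoD(2)[OF tendsto_rabs_zero[OF b(1)] that]
    by (rule eventually_conj)
  show False
  proof (cases "x = y")
    case True
    have "f' 0 \<noteq> 0"
      using D x(1) f'(3) by (simp add: virtual_link_diagram_def)
    then obtain r where r: "r > 0" "inj_on f {-r<..<r}"
      using C1_curve_locally_injective[OF f'(1,2)] by blast
    have "\<forall>\<^sub>F n in sequentially. False"
      using small[OF r(1)] eq a(2) b(2)
    proof eventually_elim
      case (elim n)
      have "a n = b n"
        using elim True by (intro inj_onD[OF r(2)]) (auto simp: f_def g_def)
      then show False using elim True Y(2)[of "k n"] by auto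
    qed
    then show False by simp
  next
    case False
    have "(\<lambda>n. f (a n)) \<longlonglongrightarrow> f 0"
      by (rule isCont_tendsto_compose[OF _ a(1)])
        (use f'(1) has_vector_derivative_continuous in blast)
    moreover have "(\<lambda>n. g (b n)) \<longlonglongrightarrow> g 0"
      by (rule isCont_tendsto_compose[OF _ b(1)])
        (use g'(1) has_vector_derivative_continuous in blast)
    then have "(\<lambda>n. f (a n)) \<longlonglongrightarrow> g 0"
      by (rule Lim_transform_eventually) (use eq in eventually_elim, simp)
    ultimately have fg: "f 0 = g 0"
      by (rule LIMSEQ_unique)
    then have fib: "x \<in> fibre D (f 0)" "y \<in> fibre D (f 0)"
      using x(1) y(1) by (auto simp: fibre_def f_def g_def)
    then have "f 0 \<in> multiple_points D"
      using False by (auto simp: multiple_points_def)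
    then have "det2 (velocity D x) (velocity D y) \<noteq> 0"
      using D fib False by (auto simp: virtual_link_diagram_def)
    then obtain r where r: "r > 0"
      "\<And>a b. \<bar>a\<bar> < r \<Longrightarrow> \<bar>b\<bar> < r \<Longrightarrow> f a = g b \<Longrightarrow> a = 0 \<and> b = 0"
      using transverse_curves_locally_meet_once[OF f'(1)[of 0] g'(1)[of 0] fg]
      unfolding f'(3) g'(2) by blast
    have "\<forall>\<^sub>F n in sequentially. False"
      using small[OF r(1)] eq a(2)
    proof eventually_elim
      case (elim n)
      then have "a n = 0" using r(2) by blast
      then show False using elim X(1)[of "k n"] by auto
    qed
    then show False by simp
  qed
qed

lemma classical_params_subset_multiple:
  assumes "virtual_link_diagram D"
  shows "classical_params D \<subseteq> multiple_params D"
  using assms by (auto simp: virtual_link_diagram_def classical_params_def multiple_params_def)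

lemma finite_classical_params:
  assumes "virtual_link_diagram D"
  shows "finite (classical_params D)"
  using finite_subset[OF classical_params_subset_multiple finite_multiple_params] assms by blast

section \<open>The two strands of a classical crossing\<close>

lemma fibre_classical:
  assumes D: "virtual_link_diagram D" and c: "c \<in> classical D"
  shows "fibre D c = {over_param D c, under_param D c}" "over_param D c \<noteq> under_param D c"
proof -
  have "card (fibre D c) = 2" and o: "over_param D c \<in> fibre D c"
    using D c by (auto simp: virtual_link_diagram_def)
  then obtain p q where "fibre D c = {p, q}" "p \<noteq> q"
    by (auto simp: card_2_iff)
  then obtain u where u: "fibre D c = {over_param D c, u}" "u \<noteq> over_param D c"
    using o by (metis insert_commute insertE singletonD)
  then have "under_param D c = u"
    unfolding under_param_def by (intro the_equality) auto
  then show "fibre D c = {over_param D c, under_param D c}" "over_param D c \<noteq> under_param D c"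
    using u by auto
qed

lemma det2_swap: "det2 w v = - det2 v w"
  by (simp add: det2_eq)

text \<open>
  The flat sign does not see which strand is on top: it is determined by the side from which the
  other strand crosses.
\<close>

lemma flat_sign_of_det2:
  assumes D: "virtual_link_diagram D" and c: "c \<in> classical D"
    and xy: "x \<in> fibre D c" "y \<in> fibre D c" "det2 (velocity D x) (velocity D y) > 0"
  shows "flat_sign D x = - 1" "flat_sign D y = 1"
proof -
  have "x \<noteq> y" using xy(3) by (auto simp: det2_eq)
  moreover have "plane_point D x = c" "plane_point D y = c"
    using xy by (auto simp: fibre_def)
  ultimately have "flat_sign D x = - 1 \<and> flat_sign D y = 1"
    using fibre_classical[OF D c] xy det2_swap[of "velocity D x" "velocity D y"]
    by (auto simp: flat_sign_def crossing_sign_def)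
  then show "flat_sign D x = - 1" "flat_sign D y = 1" by auto
qed

lemma classical_strands_cases:
  assumes D: "virtual_link_diagram D" and c: "c \<in> classical D"
    and xy: "x \<in> fibre D c" "y \<in> fibre D c" "x \<noteq> y"
  obtains "det2 (velocity D x) (velocity D y) > 0" | "det2 (velocity D y) (velocity D x) > 0"
proof -
  have "det2 (velocity D x) (velocity D y) \<noteq> 0"
    using D c xy unfolding virtual_link_diagram_def by blast
  then show ?thesis
    using that det2_swap[of "velocity D y" "velocity D x"] by linarith
qed

lemma classical_paramsE:
  assumes D: "virtual_link_diagram D" and z: "z \<in> classical_params D"
  obtains c z' where "c \<in> classical D" "z \<in> fibre D c" "z' \<in> fibre D c" "z \<noteq> z'"
proof -
  have "plane_point D z \<in> classical D" "z \<in> fibre D (plane_point D z)"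
    using z by (auto simp: classical_params_def fibre_def)
  then show ?thesis
    using that fibre_classical[OF D] by (metis insertCI)
qed

lemma flat_sign_cases:
  "flat_sign D z = 1 \<or> flat_sign D z = - 1"
  by (auto simp: flat_sign_def crossing_sign_def Let_def)

section \<open>Pieces between consecutive events\<close>

definition events :: "vdiagram \<Rightarrow> cut_point set \<Rightarrow> param set" where
  "events D C = classical_params D \<union> fst ` C"

lemma pieces_subset:
  assumes "P \<in> pieces D C"
  shows "P \<subseteq> params D - events D C" "connected P"
  using assms in_components_subset in_components_connected
  unfolding pieces_def semi_arcs_def events_def by blast+

lemma pieces_disjoint:
  assumes "P \<in> pieces D C" "Q \<in> pieces D C" "w \<in> P" "w \<in> Q"
  shows "P = Q"
proof -
  obtain A B where A: "A \<in> semi_arcs D" "P \<in> components (A - fst ` C)"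
    and B: "B \<in> semi_arcs D" "Q \<in> components (B - fst ` C)"
    using assms(1,2) unfolding pieces_def by blast
  have "w \<in> A" "w \<in> B"
    using A(2) B(2) assms(3,4) in_components_subset by blast+
  then have "A = B"
    using A(1) B(1) components_nonoverlap unfolding semi_arcs_def by blast
  then show ?thesis
    using A(2) B(2) assms(3,4) components_nonoverlap by blast
qed

text \<open>
  Because a connected set without events lies in a single semi-arc, pieces behave like the
  components of the complement of all events.
\<close>

lemma connected_subset_piece:
  assumes "connected T" "T \<noteq> {}" "T \<subseteq> params D - events D C"
  obtains P where "P \<in> pieces D C" "T \<subseteq> P"
proof -
  have "T \<subseteq> params D - classical_params D" "T \<inter> fst ` C = {}"
    using assms(3) by (auto simp: events_def)
  then obtain A where A: "A \<in> semi_arcs D" "T \<subseteq> A"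
    unfolding semi_arcs_def using exists_component_superset[of T] assms(1,2) by blast
  then have "T \<subseteq> A - fst ` C"
    using \<open>T \<inter> fst ` C = {}\<close> by blast
  then obtain P where "P \<in> components (A - fst ` C)" "T \<subseteq> P"
    using exists_component_superset[of T] assms(1,2) by blast
  then show ?thesis using that A(1) unfolding pieces_def by blast
qed

lemma eventually_piece_unique:
  assumes "P \<in> pieces D C" "Q \<in> pieces D C" "F \<noteq> bot"
    "\<forall>\<^sub>F t in F. move x t \<in> P" "\<forall>\<^sub>F t in F. move x t \<in> Q"
  shows "P = Q"
proof -
  have "\<forall>\<^sub>F t in F. move x t \<in> P \<and> move x t \<in> Q"
    using assms(4,5) by (rule eventually_conj)
  then obtain t where "move x t \<in> P" "move x t \<in> Q"
    using assms(3) eventually_happens' by blast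
  then show ?thesis using pieces_disjoint assms(1,2) by blast
qed

lemma outgoing_eqI:
  assumes "P \<in> pieces D C" "\<forall>\<^sub>F t in at_right 0. move x t \<in> P"
  shows "outgoing D C x = P"
  unfolding outgoing_def
proof (rule the_equality)
  fix Q assume "Q \<in> pieces D C \<and> (\<forall>\<^sub>F t in at_right 0. move x t \<in> Q)"
  then show "Q = P"
    using eventually_piece_unique[of Q D C P "at_right 0" x] assms by simp
qed (use assms in simp)

lemma incoming_eqI:
  assumes "P \<in> pieces D C" "\<forall>\<^sub>F t in at_left 0. move x t \<in> P"
  shows "incoming D C x = P"
  unfolding incoming_def
proof (rule the_equality)
  fix Q assume "Q \<in> pieces D C \<and> (\<forall>\<^sub>F t in at_left 0. move x t \<in> Q)"
  then show "Q = P"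
    using eventually_piece_unique[of Q D C P "at_left 0" x] assms by simp
qed (use assms in simp)

lemma event_free_path_piece:
  assumes x: "x \<in> params D" and "a < b" and free: "\<And>t. a < t \<Longrightarrow> t < b \<Longrightarrow> move x t \<notin> events D C"
  obtains P where "P \<in> pieces D C" "move x ` {a<..<b} \<subseteq> P"
    "outgoing D C (move x a) = P" "incoming D C (move x b) = P"
proof -
  have "connected (move x ` {a<..<b})"
    by (intro connected_continuous_image continuous_on_move) simp
  moreover have "move x ` {a<..<b} \<subseteq> params D - events D C" "move x ` {a<..<b} \<noteq> {}"
    using free x \<open>a < b\<close> by auto
  ultimately obtain P where P: "P \<in> pieces D C" "move x ` {a<..<b} \<subseteq> P"
    using connected_subset_piece by blast
  have "\<forall>\<^sub>F t in at_right 0. t \<in> {0<..<b - a}"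
    using \<open>a < b\<close> by (intro eventually_at_right_real) simp
  then have right: "\<forall>\<^sub>F t in at_right 0. move (move x a) t \<in> P"
    by eventually_elim (use P(2) in auto)
  have "\<forall>\<^sub>F t in at_left 0. t \<in> {a - b<..<0}"
    using \<open>a < b\<close> by (intro eventually_at_left_real) simp
  then have left: "\<forall>\<^sub>F t in at_left 0. move (move x b) t \<in> P"
    by eventually_elim (use P(2) in auto)
  show ?thesis
    using outgoing_eqI[OF P(1) right] incoming_eqI[OF P(1) left] by (rule that[OF P])
qed

text \<open>
  A property that holds shortly after a point is witnessed in its outgoing piece; this is how the
  number of that piece is read off in the construction of a cut system.
\<close>

lemma adjacent_piece_point:
  assumes x: "x \<in> params D" and fin: "finite (events D C)"
    and e: "\<forall>\<^sub>F t in at_right 0. Q (move x t)" "\<forall>\<^sub>F t in at_left 0. R (move x t)"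
  shows "outgoing D C x \<in> pieces D C" "\<exists>w\<in>outgoing D C x. Q w"
    "incoming D C x \<in> pieces D C" "\<exists>w\<in>incoming D C x. R w"
proof -
  obtain d where d: "d > 0" "\<And>t. t \<noteq> 0 \<Longrightarrow> \<bar>t\<bar> < d \<Longrightarrow> move x t \<notin> events D C"
    using eventually_move_notin_finite[OF x fin] by (auto simp: eventually_at dist_real_def)
  obtain P where P: "P \<in> pieces D C" "move x ` {0<..<d} \<subseteq> P" "outgoing D C x = P"
    by (rule event_free_path_piece[OF x d(1), of C]) (use d in auto)
  obtain P' where P': "P' \<in> pieces D C" "move x ` {-d<..<0} \<subseteq> P'" "incoming D C x = P'"
    by (rule event_free_path_piece[OF x, of "-d" 0 C]) (use d in auto)
  show "outgoing D C x \<in> pieces D C" "incoming D C x \<in> pieces D C"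
    using P P' by auto
  have "\<forall>\<^sub>F t in at_right 0. Q (move x t) \<and> t \<in> {0<..<d}"
    using e(1) eventually_at_right_real[OF d(1)] by (rule eventually_conj)
  then obtain t where "Q (move x t)" "t \<in> {0<..<d}"
    using eventually_happens'[OF trivial_limit_at_right_real] by blast
  then show "\<exists>w\<in>outgoing D C x. Q w" using P by blast
  have "\<forall>\<^sub>F t in at_left 0. R (move x t) \<and> t \<in> {-d<..<0}"
    using e(2) eventually_at_left_real[of "-d" 0] d(1) by (intro eventually_conj) auto
  then obtain t where "R (move x t)" "t \<in> {-d<..<0}"
    using eventually_happens'[OF trivial_limit_at_left_real] by blast
  then show "\<exists>w\<in>incoming D C x. R w" using P' by blast
qed

section \<open>Every cut system computes the index\<close>

text \<open>
  \<open>before t\<close> and \<open>after t\<close> stand for the numbers just before and just after time \<open>t\<close>, and \<open>E\<close> for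
  the times at which the number may jump.
\<close>

lemma telescope_jumps:
  fixes before after :: "real \<Rightarrow> int"
  assumes const: "\<And>s t. a \<le> s \<Longrightarrow> s < t \<Longrightarrow> t \<le> b \<Longrightarrow> {s<..<t} \<inter> E = {} \<Longrightarrow> after s = before t"
    and "a < b" "finite E" "E \<subseteq> {a<..<b}"
  shows "(\<Sum>t\<in>E. after t - before t) = before b - after a"
  using assms(3,2,4,1)
proof (induction E arbitrary: b rule: finite_linorder_max_induct)
  case empty
  then show ?case by (simp add: empty.prems(3)[of a b])
next
  case (insert e E)
  have "(\<Sum>t\<in>E. after t - before t) = before e - after a"
  proof (rule insert.IH)
    fix s t assume st: "a \<le> s" "s < t" "t \<le> e" "{s<..<t} \<inter> E = {}"
    show "after s = before t"
      by (rule insert.prems(3)) (use st insert.prems in auto)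
  qed (use insert in auto)
  moreover have "after e = before b"
  proof (rule insert.prems(3))
    show "{e<..<b} \<inter> insert e E = {}"
      using insert.hyps(2) by force
  qed (use insert.prems(2) in auto)
  moreover have "e \<notin> E" using insert.hyps by auto
  ultimately show ?case
    using insert.hyps(1) by simp
qed

lemma numbering_at_crossing:
  assumes "cut_numbering D C \<nu>" "c \<in> classical D" "x \<in> fibre D c" "y \<in> fibre D c"
    "det2 (velocity D x) (velocity D y) > 0"
  shows "\<nu> (incoming D C x) = \<nu> (outgoing D C x) + 1" "\<nu> (outgoing D C y) = \<nu> (incoming D C y) + 1"
    "\<nu> (outgoing D C x) = \<nu> (incoming D C y)" "\<nu> (outgoing D C y) = \<nu> (incoming D C x)"
proof -
  obtain i where "\<nu> (incoming D C y) = i" "\<nu> (outgoing D C x) = i"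
    "\<nu> (incoming D C x) = i + 1" "\<nu> (outgoing D C y) = i + 1"
    using assms unfolding cut_numbering_def by blast
  then show "\<nu> (incoming D C x) = \<nu> (outgoing D C x) + 1"
    "\<nu> (outgoing D C y) = \<nu> (incoming D C y) + 1"
    "\<nu> (outgoing D C x) = \<nu> (incoming D C y)" "\<nu> (outgoing D C y) = \<nu> (incoming D C x)"
    by simp_all
qed

lemma numbering_jump:
  assumes D: "virtual_link_diagram D" and \<nu>: "cut_numbering D C \<nu>" and z: "z \<in> classical_params D"
  shows "\<nu> (outgoing D C z) - \<nu> (incoming D C z) = flat_sign D z"
proof -
  obtain c z' where c: "c \<in> classical D" "z \<in> fibre D c" "z' \<in> fibre D c" "z \<noteq> z'"
    using classical_paramsE[OF D z] .
  from classical_strands_cases[OF D c] show ?thesis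
  proof cases
    case 1
    from numbering_at_crossing[OF \<nu> c(1,2,3) this] flat_sign_of_det2[OF D c(1,2,3) this]
    show ?thesis by simp
  next
    case 2
    from numbering_at_crossing[OF \<nu> c(1,3,2) this] flat_sign_of_det2[OF D c(1,3,2) this]
    show ?thesis by simp
  qed
qed

text \<open>
  The two pieces joined by the smoothing carry the same number, so the number returns to its
  initial value along a counting component.
\<close>

lemma numbering_closes_up:
  assumes D: "virtual_link_diagram D" and \<nu>: "cut_numbering D C \<nu>" and c: "c \<in> classical D"
    and xy: "x \<in> fibre D c" "y \<in> fibre D c" "x \<noteq> y"
  shows "\<nu> (outgoing D C x) = \<nu> (incoming D C y)"
  by (rule classical_strands_cases[OF D c xy])
    (use numbering_at_crossing[OF \<nu> c] xy in auto)

lemma sum_jumps_along_open_path: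
  assumes x: "x \<in> params D" and y: "y \<in> params D" "fst x = fst y" "x \<noteq> y"
    and fin: "finite (events D C)"
  shows "(\<Sum>z\<in>open_path x y \<inter> events D C. \<nu> (outgoing D C z) - \<nu> (incoming D C z))
    = (\<nu> (incoming D C y) - \<nu> (outgoing D C x) :: int)"
proof -
  obtain T where T: "0 < T" "T < 2 * pi" "move x T = y" "open_path x y = move x ` {0<..<T}"
    using open_path_eq_image[OF x y] .
  define E where "E = {t \<in> {0<..<T}. move x t \<in> events D C}"
  have inj: "inj_on (move x) E"
    using inj_on_move[OF x, of T] T(2) by (auto simp: E_def inj_on_def)
  have img: "move x ` E = open_path x y \<inter> events D C"
    by (auto simp: E_def T(4))
  have "finite E"
    using inj img fin by (metis finite_Int finite_imageD)
  have "(\<Sum>t\<in>E. \<nu> (outgoing D C (move x t)) - \<nu> (incoming D C (move x t)))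
    = \<nu> (incoming D C (move x T)) - \<nu> (outgoing D C (move x 0))"
  proof (rule telescope_jumps)
    fix s t assume st: "0 \<le> s" "s < t" "t \<le> T" "{s<..<t} \<inter> E = {}"
    then have "move x u \<notin> events D C" if "s < u" "u < t" for u
      using that by (auto simp: E_def disjoint_iff)
    then show "\<nu> (outgoing D C (move x s)) = \<nu> (incoming D C (move x t))"
      using event_free_path_piece[OF x st(2)] by metis
  qed (use T(1) \<open>finite E\<close> in \<open>auto simp: E_def\<close>)
  then show ?thesis
    using sum.reindex[OF inj, of "\<lambda>z. \<nu> (outgoing D C z) - \<nu> (incoming D C z)"]
    by (simp add: img T(3))
qed

lemma rho_wrt_eq_ind:
  assumes D: "virtual_link_diagram D" and c: "classical_self_crossing D c" and C: "cut_system D C"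
  shows "rho_wrt D C s c = ind D s c"
proof -
  obtain \<nu> where \<nu>: "cut_numbering D C \<nu>" and "finite C" and CD: "C \<subseteq> cut_points D"
    using C by (auto simp: cut_system_def)
  have cl: "c \<in> classical D" and fst_eq: "fst (over_param D c) = fst (under_param D c)"
    using c by (auto simp: classical_self_crossing_def)
  define x where "x = (case s of OverStrand \<Rightarrow> over_param D c | UnderStrand \<Rightarrow> under_param D c)"
  define y where "y = (case s of OverStrand \<Rightarrow> under_param D c | UnderStrand \<Rightarrow> over_param D c)"
  define L where "L = counting_component D s c"
  have L: "L = open_path x y"
    by (cases s) (auto simp: L_def x_def y_def)
  have xy: "x \<in> fibre D c" "y \<in> fibre D c" "x \<noteq> y" and fst_xy: "fst x = fst y"
    using fibre_classical[OF D cl] fst_eq by (cases s; auto simp: x_def y_def)+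
  then have par: "x \<in> params D" "y \<in> params D" by (auto simp: fibre_def)
  have fin: "finite (events D C)"
    using finite_classical_params[OF D] \<open>finite C\<close> by (simp add: events_def)
  define j where "j z = \<nu> (outgoing D C z) - \<nu> (incoming D C z)" for z
  define K where "K = L \<inter> classical_params D"
  define Co where "Co = {z \<in> L. (z, Coherent) \<in> C}"
  define In where "In = {z \<in> L. (z, Incoherent) \<in> C}"
  have jC: "j z = 1" if "z \<in> Co" for z
  proof -
    have "\<nu> (outgoing D C z) = \<nu> (incoming D C z) + 1"
      using \<nu> that unfolding cut_numbering_def Co_def by blast
    then show ?thesis by (simp add: j_def)
  qed
  have jI: "j z = - 1" if "z \<in> In" for z
  proof -
    have "\<nu> (incoming D C z) = \<nu> (outgoing D C z) + 1"
      using \<nu> that unfolding cut_numbering_def In_def by blast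
    then show ?thesis by (simp add: j_def)
  qed
  have "z \<notin> classical_params D" if "(z, d) \<in> C" for z d
    using that CD in_components_subset unfolding cut_points_def semi_arcs_def by blast
  then have "K \<inter> Co = {}" "K \<inter> In = {}"
    unfolding K_def Co_def In_def by blast+
  moreover have "Co \<inter> In = {}"
  proof (rule equals0I)
    fix z assume "z \<in> Co \<inter> In"
    then show False using jC[of z] jI[of z] by simp
  qed
  ultimately have disj: "K \<inter> Co = {}" "(K \<union> Co) \<inter> In = {}"
    by blast+
  have "z \<in> fst ` C \<longleftrightarrow> (z, Coherent) \<in> C \<or> (z, Incoherent) \<in> C" for z
    by (auto intro: rev_image_eqI) (metis direction.exhaust)
  then have ev: "L \<inter> events D C = K \<union> Co \<union> In"
    unfolding events_def K_def Co_def In_def by blast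
  have "finite (L \<inter> events D C)"
    using fin by simp
  then have fins: "finite K" "finite Co" "finite In"
    by (simp_all add: ev)
  have "0 = (\<Sum>z\<in>L \<inter> events D C. j z)"
    using sum_jumps_along_open_path[OF par fst_xy xy(3) fin, of \<nu>]
      numbering_closes_up[OF D \<nu> cl xy] by (simp add: L j_def)
  also have "\<dots> = (\<Sum>z\<in>K. j z) + (\<Sum>z\<in>Co. j z) + (\<Sum>z\<in>In. j z)"
    using fins disj by (simp add: ev sum.union_disjoint)
  also have "\<dots> = (\<Sum>z\<in>K. flat_sign D z) + int (card Co) - int (card In)"
    using jC jI numbering_jump[OF D \<nu>] by (simp add: K_def j_def)
  finally show ?thesis
    by (simp add: rho_wrt_def ind_def K_def Co_def In_def L_def)
qed

section \<open>Existence of a cut system\<close>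

text \<open>
  Away from the two endpoints, the arc and its complement are both closed, so a connected set that
  avoids the endpoints cannot leave the arc.
\<close>

lemma connected_subset_arc:
  assumes x: "x \<in> params D" and ab: "a < b" "b < a + 2 * pi"
    and P: "connected P" "P \<subseteq> params D" "move x a \<notin> P" "move x b \<notin> P"
    and w: "w \<in> P" "w \<in> move x ` {a<..<b}"
  shows "P \<subseteq> move x ` {a<..<b}"
proof -
  define A where "A = move x ` {a..b}"
  define B where "B = move x ` {b..a + 2 * pi} \<union> (- {fst x}) \<times> UNIV"
  have clA: "closed A"
    unfolding A_def by (intro compact_imp_closed compact_continuous_image continuous_on_move) simp
  have "closed (move x ` {b..a + 2 * pi})"
    by (intro compact_imp_closed compact_continuous_image continuous_on_move) simp
  moreover have "closed ((- {fst x}) \<times> (UNIV :: complex set))"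
    by (intro closed_Times closed_UNIV) (simp add: closed_def open_discrete)
  ultimately have clB: "closed B"
    unfolding B_def by (rule closed_Un)
  have cover: "P \<subseteq> A \<union> B"
  proof
    fix p assume p: "p \<in> P"
    show "p \<in> A \<union> B"
    proof (cases "fst p = fst x")
      case True
      then obtain t where "a \<le> t" "t < a + 2 * pi" "move x t = p"
        using move_reaches[OF x, of p] p P(2) by (metis subsetD)
      then have "p \<in> move x ` {a..b} \<or> p \<in> move x ` {b..a + 2 * pi}"
        by (cases "t \<le> b") (auto intro: rev_image_eqI[of t])
      then show ?thesis
        unfolding A_def B_def by blast
    qed (simp add: B_def mem_Times_iff)
  qed
  have AP: "A \<inter> P \<subseteq> move x ` {a<..<b}"
  proof
    fix p assume "p \<in> A \<inter> P"
    then obtain t where t: "p = move x t" "a \<le> t" "t \<le> b" "p \<in> P"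
      by (auto simp: A_def)
    then have "t \<noteq> a" "t \<noteq> b" using P(3,4) by auto
    then show "p \<in> move x ` {a<..<b}" using t by auto
  qed
  have AB: "move x ` {a<..<b} \<inter> B \<inter> P = {}"
  proof -
    have "p \<notin> B" if p: "p \<in> move x ` {a<..<b}" for p
    proof
      assume "p \<in> B"
      obtain t where t: "p = move x t" "a < t" "t < b" using p by auto
      then have "fst p = fst x" by simp
      then obtain s where s: "p = move x s" "b \<le> s" "s \<le> a + 2 * pi"
        using \<open>p \<in> B\<close> by (auto simp: B_def)
      have "t = s"
        using t s by (intro move_eq_imp_eq[OF x]) auto
      then show False using t s by simp
    qed
    then show ?thesis by blast
  qed
  have "w \<in> A" using w(2) by (auto simp: A_def)
  moreover have "A \<inter> B \<inter> P = {}" using AP AB by blast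
  ultimately have "B \<inter> P = {}"
    using connected_closedD[OF P(1) _ cover clA clB] w(1) by blast
  then show ?thesis using cover AP by blast
qed

text \<open>
  All pieces are numbered 0 except for a short one at every passage through a classical crossing.
  At a passage of flat sign 1 the number rises from 0 to 1, and an incoherent cut point shortly
  after it brings the number back to 0; at a passage of flat sign -1 a coherent cut point
  shortly before it raises the number to 1.
\<close>

lemma cut_system_exists:
  assumes D: "virtual_link_diagram D"
  shows "\<exists>C. cut_system D C"
proof -
  define K where "K = classical_params D"
  define M where "M = multiple_params D"
  have KM: "K \<subseteq> M" and finK: "finite K" and finM: "finite M" and MP: "M \<subseteq> params D"
    using classical_params_subset_multiple[OF D] finite_classical_params[OF D]
      finite_multiple_params[OF D] by (auto simp: K_def M_def multiple_params_def)
  then have KP: "z \<in> params D" if "z \<in> K" for z using that by blast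
  have "\<forall>\<^sub>F t in at 0. \<forall>z\<in>K. move z t \<notin> M"
    using eventually_move_notin_finite[OF KP finM] finK by (simp add: eventually_ball_finite)
  then obtain d where d: "d > 0" "\<And>t z. t \<noteq> 0 \<Longrightarrow> \<bar>t\<bar> < d \<Longrightarrow> z \<in> K \<Longrightarrow> move z t \<notin> M"
    by (auto simp: eventually_at dist_real_def)
  \<comment> \<open>\<open>sep\<close> below compares times up to \<open>2 * \<epsilon>\<close> around two passages, hence the quarter;
    the bound 1 keeps a short arc from being a full turn\<close>
  define \<epsilon> where "\<epsilon> = min (d / 4) 1"
  have \<epsilon>: "\<epsilon> > 0" "4 * \<epsilon> \<le> d" "\<epsilon> \<le> 1" using d(1) by (auto simp: \<epsilon>_def)
  have \<epsilon>pi: "\<epsilon> < 2 * pi" using \<epsilon>(3) pi_gt3 by simp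
  define \<sigma> where "\<sigma> z = real_of_int (flat_sign D z)" for z
  have \<sigma>: "\<sigma> z = 1 \<or> \<sigma> z = - 1" for z
    using flat_sign_cases[of D z] by (auto simp: \<sigma>_def)
  define arc where "arc z = (\<lambda>s. move z (\<sigma> z * s)) ` {0<..<\<epsilon>}" for z
  define U where "U = (\<Union>z\<in>K. arc z)"
  define C where
    "C = (\<lambda>z. (move z (\<sigma> z * \<epsilon>), if \<sigma> z = 1 then Incoherent else Coherent)) ` K"
  define \<nu> :: "param set \<Rightarrow> int" where "\<nu> P = (if P \<inter> U = {} then 0 else 1)" for P
  have ev: "events D C = K \<union> (\<lambda>z. move z (\<sigma> z * \<epsilon>)) ` K"
    by (auto simp: events_def C_def K_def image_image)
  then have fin: "finite (events D C)" using finK by simp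

  \<comment> \<open>the passages are so far apart that short arcs near different passages do not meet\<close>
  have sep: "z = z' \<and> s = t"
    if "z \<in> K" "z' \<in> K" "\<bar>s\<bar> < 2 * \<epsilon>" "\<bar>t\<bar> < 2 * \<epsilon>" "move z s = move z' t" for z z' s t
  proof -
    have "move z (s - t) = move (move z s) (- t)" by simp
    also have "\<dots> = z'" using that(5) by simp
    finally have "move z (s - t) = z'" .
    moreover from this have "s - t = 0"
      using d(2)[of "s - t" z] that KM \<epsilon>(2) by fastforce
    ultimately show ?thesis by auto
  qed

  have inU: "move z t \<in> U \<longleftrightarrow> 0 < \<sigma> z * t \<and> \<sigma> z * t < \<epsilon>" if "z \<in> K" "\<bar>t\<bar> < 2 * \<epsilon>" for z t
  proof
    assume "move z t \<in> U"
    then obtain z' s where s: "z' \<in> K" "0 < s" "s < \<epsilon>" "move z t = move z' (\<sigma> z' * s)"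
      by (auto simp: U_def arc_def)
    have "\<bar>\<sigma> z' * s\<bar> < 2 * \<epsilon>" using \<sigma>[of z'] s by auto
    from sep[OF that(1) s(1) that(2) this s(4)] have "t = \<sigma> z * s" by auto
    then show "0 < \<sigma> z * t \<and> \<sigma> z * t < \<epsilon>" using \<sigma>[of z] s by auto
  next
    assume "0 < \<sigma> z * t \<and> \<sigma> z * t < \<epsilon>"
    then have "\<sigma> z * t \<in> {0<..<\<epsilon>}" by (simp only: greaterThanLessThan_iff)
    then have "move z (\<sigma> z * (\<sigma> z * t)) \<in> arc z"
      unfolding arc_def by (rule imageI)
    moreover have "\<sigma> z * (\<sigma> z * t) = t" using \<sigma>[of z] by auto
    ultimately have "move z t \<in> arc z" by (simp only:)
    then show "move z t \<in> U" using that(1) by (auto simp: U_def)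
  qed

  have piece_arc: "P \<subseteq> arc z" if P: "P \<in> pieces D C" and z: "z \<in> K" "w \<in> P" "w \<in> arc z" for P z w
  proof -
    have ends: "z \<notin> P" "move z (\<sigma> z * \<epsilon>) \<notin> P"
      using pieces_subset(1)[OF P] z(1) by (auto simp: ev)
    have P': "connected P" "P \<subseteq> params D"
      using pieces_subset[OF P] by auto
    show ?thesis
    proof (cases "\<sigma> z = 1")
      case True
      then have "arc z = move z ` {0<..<\<epsilon>}" by (simp add: arc_def)
      then show ?thesis
        using connected_subset_arc[OF KP[OF z(1)] \<epsilon>(1) _ P' _ _ z(2)] \<epsilon>pi ends z(3) True by auto
    next
      case False
      then have m: "\<sigma> z = - 1" using \<sigma>[of z] by simp
      have "arc z = move z ` uminus ` {0<..<\<epsilon>}"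
        unfolding arc_def image_image by (simp add: m)
      then have "arc z = move z ` {-\<epsilon><..<0}" by simp
      then show ?thesis
        using connected_subset_arc[OF KP[OF z(1)], of "-\<epsilon>" 0 P w] \<epsilon> \<epsilon>pi P' ends z m by auto
    qed
  qed
  have \<nu>_point: "\<nu> P = (if w \<in> U then 1 else 0)" if "P \<in> pieces D C" "w \<in> P" for P w
  proof (cases "P \<inter> U = {}")
    case False
    then obtain z w' where "z \<in> K" "w' \<in> P" "w' \<in> arc z" by (auto simp: U_def)
    then have "P \<subseteq> U"
      using piece_arc[OF that(1), of z w'] unfolding U_def by blast
    then show ?thesis using that by (auto simp: \<nu>_def)
  qed (use that in \<open>auto simp: \<nu>_def\<close>)

  have near: "\<forall>\<^sub>F t in at_right 0. 0 < t \<and> t < \<epsilon>" "\<forall>\<^sub>F t in at_left 0. - \<epsilon> < t \<and> t < 0"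
    using eventually_at_right_real[OF \<epsilon>(1)] eventually_at_left_real[of "-\<epsilon>" 0] \<epsilon>(1) by auto
  have numbers: "\<nu> (outgoing D C x) = (if p then 1 else 0)" "\<nu> (incoming D C x) = (if q then 1 else 0)"
    if x: "x \<in> params D"
      and p: "\<And>t. 0 < t \<Longrightarrow> t < \<epsilon> \<Longrightarrow> move x t \<in> U \<longleftrightarrow> p"
      and q: "\<And>t. - \<epsilon> < t \<Longrightarrow> t < 0 \<Longrightarrow> move x t \<in> U \<longleftrightarrow> q" for x p q
  proof -
    have "\<forall>\<^sub>F t in at_right 0. move x t \<in> U \<longleftrightarrow> p" "\<forall>\<^sub>F t in at_left 0. move x t \<in> U \<longleftrightarrow> q"
      using near p q by (auto elim: eventually_mono)
    note pt = adjacent_piece_point[OF x fin this]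
    from pt(2) obtain w where "w \<in> outgoing D C x" "w \<in> U \<longleftrightarrow> p" by auto
    then show "\<nu> (outgoing D C x) = (if p then 1 else 0)"
      using \<nu>_point[OF pt(1)] by auto
    from pt(4) obtain w where "w \<in> incoming D C x" "w \<in> U \<longleftrightarrow> q" by auto
    then show "\<nu> (incoming D C x) = (if q then 1 else 0)"
      using \<nu>_point[OF pt(3)] by auto
  qed

  have at_passage: "\<nu> (outgoing D C z) = (if \<sigma> z = 1 then 1 else 0)"
    "\<nu> (incoming D C z) = (if \<sigma> z = 1 then 0 else 1)" if z: "z \<in> K" for z
  proof -
    have "move z t \<in> U \<longleftrightarrow> \<sigma> z = 1" if "0 < t" "t < \<epsilon>" for t
      using inU[OF z, of t] \<sigma>[of z] that by auto
    moreover have "move z t \<in> U \<longleftrightarrow> \<sigma> z \<noteq> 1" if "- \<epsilon> < t" "t < 0" for t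
      using inU[OF z, of t] \<sigma>[of z] that by auto
    ultimately show "\<nu> (outgoing D C z) = (if \<sigma> z = 1 then 1 else 0)"
      "\<nu> (incoming D C z) = (if \<sigma> z = 1 then 0 else 1)"
      using numbers[OF KP[OF z], of "\<sigma> z = 1" "\<sigma> z \<noteq> 1"] by auto
  qed
  have at_cut: "\<nu> (outgoing D C (move z (\<sigma> z * \<epsilon>))) = (if \<sigma> z = 1 then 0 else 1)"
    "\<nu> (incoming D C (move z (\<sigma> z * \<epsilon>))) = (if \<sigma> z = 1 then 1 else 0)" if z: "z \<in> K" for z
  proof -
    let ?x = "move z (\<sigma> z * \<epsilon>)"
    have "move ?x t \<in> U \<longleftrightarrow> \<sigma> z \<noteq> 1" if "0 < t" "t < \<epsilon>" for t
      using inU[OF z, of "\<sigma> z * \<epsilon> + t"] \<sigma>[of z] that by auto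
    moreover have "move ?x t \<in> U \<longleftrightarrow> \<sigma> z = 1" if "- \<epsilon> < t" "t < 0" for t
      using inU[OF z, of "\<sigma> z * \<epsilon> + t"] \<sigma>[of z] that by auto
    ultimately show "\<nu> (outgoing D C ?x) = (if \<sigma> z = 1 then 0 else 1)"
      "\<nu> (incoming D C ?x) = (if \<sigma> z = 1 then 1 else 0)"
      using numbers[of ?x "\<sigma> z \<noteq> 1" "\<sigma> z = 1"] KP[OF z] by auto
  qed

  have "cut_numbering D C \<nu>"
    unfolding cut_numbering_def
  proof (intro conjI ballI allI impI)
    fix c x y
    assume cxy: "c \<in> classical D" "x \<in> fibre D c" "y \<in> fibre D c"
      "det2 (velocity D x) (velocity D y) > 0"
    have "x \<in> K" "y \<in> K"
      using cxy by (auto simp: K_def classical_params_def fibre_def)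
    moreover have "\<sigma> x = - 1" "\<sigma> y = 1"
      using flat_sign_of_det2[OF D cxy] by (auto simp: \<sigma>_def)
    ultimately show "\<exists>i. \<nu> (incoming D C y) = i \<and> \<nu> (outgoing D C x) = i \<and>
        \<nu> (incoming D C x) = i + 1 \<and> \<nu> (outgoing D C y) = i + 1"
      using at_passage by auto
  next
    fix x assume "(x, Coherent) \<in> C"
    then obtain z where "z \<in> K" "x = move z (\<sigma> z * \<epsilon>)" "\<sigma> z \<noteq> 1"
      by (auto simp: C_def split: if_splits)
    then show "\<nu> (outgoing D C x) = \<nu> (incoming D C x) + 1"
      using at_cut by simp
  next
    fix x assume "(x, Incoherent) \<in> C"
    then obtain z where "z \<in> K" "x = move z (\<sigma> z * \<epsilon>)" "\<sigma> z = 1"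
      by (auto simp: C_def split: if_splits)
    then show "\<nu> (incoming D C x) = \<nu> (outgoing D C x) + 1"
      using at_cut[of z] by simp
  qed
  moreover have "C \<subseteq> cut_points D"
  proof
    fix q assume "q \<in> C"
    then obtain z where z: "z \<in> K" "fst q = move z (\<sigma> z * \<epsilon>)" by (auto simp: C_def)
    have "fst q \<notin> M"
      unfolding z(2) using \<sigma>[of z] \<epsilon> z(1) by (intro d(2)) auto
    moreover have par: "fst q \<in> params D" using z KP by simp
    ultimately have mult: "plane_point D (fst q) \<notin> multiple_points D"
      and "fst q \<in> params D - classical_params D"
      using KM by (auto simp: M_def multiple_params_def K_def)
    then obtain A where "A \<in> semi_arcs D" "fst q \<in> A"
      unfolding semi_arcs_def using Union_components by blast
    then show "q \<in> cut_points D"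
      using mult by (cases q) (auto simp: cut_points_def)
  qed
  moreover have "finite C" using finK by (simp add: C_def)
  ultimately show ?thesis unfolding cut_system_def by blast
qed

section \<open>The common value of all cut systems\<close>

theorem theorem17:
  fixes D :: vdiagram and c :: "real^2" and s :: strand
  assumes "virtual_link_diagram D"
    and "classical_self_crossing D c"
  shows "rho D s c = ind D s c"
  unfolding rho_def
proof (rule the_equality)
  show "\<forall>C. cut_system D C \<longrightarrow> rho_wrt D C s c = ind D s c"
    using rho_wrt_eq_ind[OF assms] by blast
  fix r assume "\<forall>C. cut_system D C \<longrightarrow> rho_wrt D C s c = r"
  then show "r = ind D s c"
    using cut_system_exists[OF assms(1)] rho_wrt_eq_ind[OF assms] by blast
qed

end
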